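(* Let $\Omega, \Lambda \subset \mathbf{R}^d$ be two bounded Lebesgue measurable sets of unit volume which are balanced, meaning $\Omega = -\Omega$ and $\Lambda = -\Lambda$. Let $f = 1_\Omega$ and $g = 1_\Lambda$, let $\bar h_2 := 2 \cdot 1_{\Omega \times \Lambda}$, and let $c(x,y) = -x \cdot y$. Then the minimizer of $c[\cdot]$ on $\Gamma(1_\Omega, 1_\Lambda)^{\bar h_2}$, which is of the form $\bar h_2 1_W$ for a measurable set $W \subset \Omega \times \Lambda$, satisfies $W = R(\tilde W) = -R(\tilde W)$ up to sets of measure zero, where $R(x,y) = (x,-y)$ and $\tilde W = (\Omega \times \Lambda) \setminus W$. It follows that, up to sets of measure zero, $W = \{(x,y) \in \Omega \times \Lambda \mid x \cdot y > 0\}$.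
   Context: For $0 \le f, g \in L^1(\mathbf{R}^d)$ with $\int f = \int g$ and $0 \le \bar h \in L^1(\mathbf{R}^d \times \mathbf{R}^d)$, the set $\Gamma(f,g)^{\bar h}$ consists of all $0 \le h \in L^1(\mathbf{R}^d \times \mathbf{R}^d)$ (functions identified when equal Lebesgue-a.e.) such that $\int_{\mathbf{R}^d} h(x,\tilde y)\,d\tilde y = f(x)$ for Lebesgue-a.e. $x$, $\int_{\mathbf{R}^d} h(\tilde x,y)\,d\tilde x = g(y)$ for Lebesgue-a.e. $y$, and $h \le \bar h$ almost everywhere. The transportation cost of $h$ is $c[h] := \int_{\mathbf{R}^d \times \mathbf{R}^d} c(x,y) h(x,y)\,dx\,dy$. "The minimizer" is the almost-everywhere unique $h \in \Gamma(1_\Omega,1_\Lambda)^{\bar h_2}$ at which $c[\cdot]$ attains its minimum over this set. $1_A$ denotes the indicator function of the set $A$, and for any set $A$ in a Euclidean space $-A = \{-z \mid z \in A\}$; thus $-R(\tilde W) = \{(-x,y) \mid (x,y) \in \tilde W\}$. *)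

theory Defs
  imports "HOL-Analysis.Analysis"
begin

(* Elements of L^1 are represented by functions that are integrable
   for the complete Lebesgue measure, so all pointwise conditions hold only almost
   everywhere.  By Fubini almost every slice of an integrable h is integrable,
   hence the marginal integrals are genuine for almost every x (resp. y). *)
definition couplings ::
  "('a::euclidean_space \<Rightarrow> real) \<Rightarrow> ('b::euclidean_space \<Rightarrow> real) \<Rightarrow> ('a \<times> 'b \<Rightarrow> real)
    \<Rightarrow> ('a \<times> 'b \<Rightarrow> real) set" where
  "couplings f g hbar = {h.
     integrable lebesgue h \<and>
     (AE z in lebesgue. 0 \<le> h z) \<and>
     (AE x in lebesgue. (LINT y|lebesgue. h (x, y)) = f x) \<and>
     (AE y in lebesgue. (LINT x|lebesgue. h (x, y)) = g y) \<and>
     (AE z in lebesgue. h z \<le> hbar z)}"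

(* The Bochner integral is 0 if the integrand is not integrable.  This does not occur
   for c continuous and h integrable with h = 0 almost everywhere off a bounded set. *)
definition transport_cost ::
  "('a::euclidean_space \<Rightarrow> 'b::euclidean_space \<Rightarrow> real) \<Rightarrow> ('a \<times> 'b \<Rightarrow> real) \<Rightarrow> real" where
  "transport_cost c h = (LINT z|lebesgue. c (fst z) (snd z) * h z)"

definition cost_minimizer ::
  "('a::euclidean_space \<Rightarrow> 'b::euclidean_space \<Rightarrow> real) \<Rightarrow> ('a \<times> 'b \<Rightarrow> real) set
    \<Rightarrow> ('a \<times> 'b \<Rightarrow> real) \<Rightarrow> bool" where
  "cost_minimizer c S h \<longleftrightarrow>
     h \<in> S \<and> (\<forall>h'\<in>S. transport_cost c h \<le> transport_cost c h')"

definition null_eq :: "'a::euclidean_space set \<Rightarrow> 'a set \<Rightarrow> bool" where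
  "null_eq A B \<longleftrightarrow> (A - B) \<union> (B - A) \<in> null_sets lebesgue"

definition hbar2 :: "'a set \<Rightarrow> 'b set \<Rightarrow> 'a \<times> 'b \<Rightarrow> real" where
  "hbar2 \<Omega> \<Lambda> = (\<lambda>z. 2 * indicator (\<Omega> \<times> \<Lambda>) z)"

definition R :: "'a \<times> 'b::uminus \<Rightarrow> 'a \<times> 'b" where
  "R = (\<lambda>(x, y). (x, - y))"

end

theory Submission
  imports Defs
begin

text \<open>
  Write \<open>P\<close> for the set of those \<open>(x, y)\<close> in \<open>\<Omega> \<times> \<Lambda>\<close> with \<open>x \<bullet> y > 0\<close>.  Minimizing the cost
  means maximizing the integral of \<open>x \<bullet> y\<close> against \<open>h\<close>.  If the marginal constraints are dropped
  and only \<open>0 \<le> h \<le> hbar2\<close> is kept, the bathtub principle (\<open>bathtub_le\<close>, \<open>bathtub_unique\<close>) says that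
  the best choice is to take \<open>h = hbar2\<close> where \<open>x \<bullet> y > 0\<close> and \<open>h = 0\<close> where \<open>x \<bullet> y < 0\<close>.  Since
  orthogonal pairs form a null set (\<open>AE_not_orthogonal\<close>), this determines the relaxed optimizer
  almost everywhere: it is \<open>hbar2\<close> times the indicator of \<open>P\<close>.

  The symmetry hypothesis is what makes this relaxed optimizer admissible.  For \<open>x \<noteq> 0\<close> the
  reflection \<open>y \<mapsto> -y\<close> preserves \<open>\<Lambda>\<close> and exchanges the open half spaces on both sides of the
  hyperplane orthogonal to \<open>x\<close>, so exactly half of \<open>\<Lambda>\<close> has \<open>x \<bullet> y > 0\<close>
  (\<open>measure_balanced_halfspace\<close>); the factor 2 in \<open>hbar2\<close> restores the marginal \<open>1\<close>.  The other
  marginal is the same computation with the roles of the two factors exchanged.  Hence the relaxed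
  optimizer is the minimizer of the constrained problem, and it is unique.

  Consequently a set \<open>W\<close> representing the minimizer agrees with \<open>P\<close> up to a null set.  The two
  symmetries of \<open>W\<close> follow from those of \<open>P\<close>: reflecting the complement of \<open>P\<close> in the second factor
  gives the pairs with \<open>x \<bullet> y \<ge> 0\<close>, a set that is invariant under \<open>z \<mapsto> -z\<close> and differs from \<open>P\<close> by
  orthogonal pairs only, and linear maps preserve null sets.
\<close>

section \<open>The bathtub principle\<close>

text \<open>
  Think of \<open>p\<close> as the gain per unit of mass and of \<open>b\<close> as the capacity: where \<open>p\<close> is positive, full
  capacity beats \<open>h\<close> because \<open>h \<le> b\<close>, and elsewhere the empty choice beats \<open>h\<close> because \<open>0 \<le> h\<close>.
  The integrated inequality follows from this pointwise one, and so does its equality case.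
\<close>

lemma bathtub_integrand_nonneg:
  fixes p h b :: "'a \<Rightarrow> real"
  assumes "0 \<le> h z" and "h z \<le> b z"
  shows "0 \<le> p z * (b z * indicator {z. p z > 0} z) - p z * h z"
proof (cases "p z > 0")
  case True
  then show ?thesis using assms by (simp add: mult_left_mono)
next
  case False
  then show ?thesis using assms by (simp add: mult_nonpos_nonneg)
qed

lemma bathtub_le:
  fixes p h b :: "'a \<Rightarrow> real"
  assumes "integrable M (\<lambda>z. p z * h z)"
    and "integrable M (\<lambda>z. p z * (b z * indicator {z. p z > 0} z))"
    and "AE z in M. 0 \<le> h z" and "AE z in M. h z \<le> b z"
  shows "(LINT z|M. p z * h z) \<le> (LINT z|M. p z * (b z * indicator {z. p z > 0} z))"
proof (rule integral_mono_AE[OF assms(1,2)])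
  show "AE z in M. p z * h z \<le> p z * (b z * indicator {z. p z > 0} z)"
    using assms(3,4)
  proof eventually_elim
    case (elim z)
    from bathtub_integrand_nonneg[of h z b p, OF elim] show ?case by simp
  qed
qed

text \<open>
  Equality of the integrals forces equality in the pointwise inequality almost everywhere.  Where
  \<open>p\<close> vanishes that says nothing about \<open>h\<close>, so the zero set of \<open>p\<close> has to be null.
\<close>

lemma bathtub_unique:
  fixes p h b :: "'a \<Rightarrow> real"
  assumes "integrable M (\<lambda>z. p z * h z)"
    and "integrable M (\<lambda>z. p z * (b z * indicator {z. p z > 0} z))"
    and "AE z in M. 0 \<le> h z" and "AE z in M. h z \<le> b z"
    and "AE z in M. p z \<noteq> 0"
    and "(LINT z|M. p z * (b z * indicator {z. p z > 0} z)) \<le> (LINT z|M. p z * h z)"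
  shows "AE z in M. h z = b z * indicator {z. p z > 0} z"
proof -
  let ?D = "\<lambda>z. p z * (b z * indicator {z. p z > 0} z) - p z * h z"
  have int: "integrable M ?D"
    using assms(1,2) by (rule Bochner_Integration.integrable_diff[rotated])
  have nonneg: "AE z in M. 0 \<le> ?D z"
    using assms(3,4) by eventually_elim (rule bathtub_integrand_nonneg)
  have "integral\<^sup>L M ?D = 0"
    using bathtub_le[OF assms(1-4)] assms(6)
    by (simp add: Bochner_Integration.integral_diff[OF assms(2,1)])
  then have "AE z in M. ?D z = 0"
    using integral_nonneg_eq_0_iff_AE[OF int nonneg] by blast
  with assms(5) show ?thesis
  proof eventually_elim
    case (elim z)
    then have "p z * h z = p z * (b z * indicator {z. p z > 0} z)" by linarith
    with elim(1) show ?case using mult_left_cancel by blast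
  qed
qed

section \<open>Lebesgue measure on products\<close>

text \<open>
  The Lebesgue measure on the product space is the completion of the product of the Borel--Lebesgue
  measures.  Measurability of a rectangle with Lebesgue measurable sides is obtained from Borel sides: the
  error lies in two strips over Borel null sets, and a strip over a null set is null.
\<close>

lemma lebesgue_Times:
  fixes A :: "'a::euclidean_space set" and B :: "'b::euclidean_space set"
  assumes "A \<in> sets lebesgue" and "B \<in> sets lebesgue"
  shows "A \<times> B \<in> sets lebesgue"
proof -
  obtain A0 A1 NA where A: "A = A0 \<union> A1" "A1 \<subseteq> NA" "NA \<in> null_sets lborel" "A0 \<in> sets lborel"
    using assms(1) by (rule sets_completionE)
  obtain B0 B1 NB where B: "B = B0 \<union> B1" "B1 \<subseteq> NB" "NB \<in> null_sets lborel" "B0 \<in> sets lborel"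
    using assms(2) by (rule sets_completionE)
  have UA: "NA \<times> UNIV \<in> null_sets (lborel :: ('a \<times> 'b) measure)"
    using A(3) by (auto simp: lborel_prod[symmetric] null_sets_def lborel.emeasure_pair_measure_Times)
  have UB: "UNIV \<times> NB \<in> null_sets (lborel :: ('a \<times> 'b) measure)"
    using B(3) by (auto simp: lborel_prod[symmetric] null_sets_def lborel.emeasure_pair_measure_Times)
  have 0: "A0 \<times> B0 \<in> sets (lborel :: ('a \<times> 'b) measure)"
    using A(4) B(4) by (auto simp: lborel_prod[symmetric])
  show ?thesis
  proof (rule sets_completionI)
    show "A \<times> B = A0 \<times> B0 \<union> (A \<times> B - A0 \<times> B0)" using A(1) B(1) by auto
    show "A \<times> B - A0 \<times> B0 \<subseteq> NA \<times> UNIV \<union> UNIV \<times> NB" using A(1,2) B(1,2) by auto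
    show "NA \<times> UNIV \<union> UNIV \<times> NB \<in> null_sets lborel" using UA UB by (rule null_sets.Un)
  qed (rule 0)
qed

text \<open>By Fubini, since each slice over \<open>x \<noteq> 0\<close> is a hyperplane.\<close>

lemma AE_not_orthogonal:
  "AE z in (lebesgue :: ('a \<times> 'a::euclidean_space) measure). fst z \<bullet> snd z \<noteq> 0"
proof -
  have slice: "AE y in lborel. x \<bullet> y \<noteq> 0" if "x \<noteq> 0" for x :: 'a
  proof -
    have "AE y in lebesgue. x \<bullet> y \<noteq> 0"
      using negligible_hyperplane[of x 0] that
      by (auto simp: negligible_iff_null_sets intro!: AE_I'[where N = "{y. x \<bullet> y = 0}"])
    then show ?thesis by (simp add: AE_completion_iff)
  qed
  have "AE z in (lborel :: 'a measure) \<Otimes>\<^sub>M (lborel :: 'a measure). fst z \<bullet> snd z \<noteq> (0::real)"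
  proof (rule lborel_pair.AE_pair_measure)
    show "AE x::'a in lborel. AE y in lborel. fst (x, y) \<bullet> snd (x, y) \<noteq> 0"
      using AE_lborel_singleton[of "0::'a"] by eventually_elim (simp add: slice)
  qed measurable
  then show ?thesis
    unfolding lborel_prod by (rule AE_completion)
qed

lemma integrable_continuous_mult_bounded_support:
  fixes p h :: "'a::euclidean_space \<Rightarrow> real"
  assumes "continuous_on UNIV p" and "integrable lebesgue h"
    and "bounded S" and "AE z in lebesgue. z \<notin> S \<longrightarrow> h z = 0"
  shows "integrable lebesgue (\<lambda>z. p z * h z)"
proof -
  have "compact (closure S)" using assms(3) by simp
  then have "bounded (p ` closure S)"
    using assms(1) by (intro compact_imp_bounded compact_continuous_image)
      (auto intro: continuous_on_subset)
  then obtain C where C: "\<And>z. z \<in> closure S \<Longrightarrow> \<bar>p z\<bar> \<le> C"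
    by (auto simp: bounded_iff)
  have p: "p \<in> borel_measurable lebesgue"
    using assms(1) by (intro measurable_completion) (simp add: borel_measurable_continuous_onI)
  show ?thesis
  proof (rule Bochner_Integration.integrable_bound)
    show "integrable lebesgue (\<lambda>z. C * h z)" using assms(2) by simp
    show "(\<lambda>z. p z * h z) \<in> borel_measurable lebesgue"
      using p assms(2) by (intro borel_measurable_times) auto
    show "AE z in lebesgue. norm (p z * h z) \<le> norm (C * h z)"
      using assms(4)
    proof eventually_elim
      case (elim z)
      show ?case
      proof (cases "z \<in> S")
        case True
        then have "\<bar>p z\<bar> \<le> \<bar>C\<bar>" using C[of z] closure_subset[of S] by force
        then show ?thesis by (simp add: abs_mult mult_right_mono)
      qed (use elim in simp)
    qed
  qed
qed

section \<open>Half spaces of a balanced set\<close>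

text \<open>
  The reflection through the origin preserves the measure and exchanges the two open halves; what
  lies on the hyperplane between them is negligible.
\<close>

lemma measure_balanced_halfspace:
  fixes S :: "'a::euclidean_space set"
  assumes "S \<in> lmeasurable" and "S = uminus ` S" and "a \<noteq> 0"
  shows "measure lebesgue (S \<inter> {y. a \<bullet> y > 0}) = measure lebesgue S / 2"
proof -
  let ?P = "S \<inter> {y. a \<bullet> y > 0}" and ?N = "S \<inter> {y. a \<bullet> y < 0}"
  have P: "?P \<in> lmeasurable" and N: "?N \<in> lmeasurable"
    using assms(1) by (auto intro!: fmeasurable_Int_fmeasurable simp: open_halfspace_gt open_halfspace_lt)
  have bal: "- y \<in> S \<longleftrightarrow> y \<in> S" for y
    using assms(2) by (metis image_eqI minus_minus rev_image_eqI)
  have "uminus ` ?P = ?N"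
  proof
    show "?N \<subseteq> uminus ` ?P"
    proof
      fix y assume "y \<in> ?N"
      then show "y \<in> uminus ` ?P" using bal by (intro image_eqI[of _ _ "- y"]) auto
    qed
  qed (use bal in auto)
  then have eq: "measure lebesgue ?N = measure lebesgue ?P"
    using measure_lebesgue_affine[of "-1" "0::'a" ?P] by simp
  have "measure lebesgue S = measure lebesgue (?P \<union> ?N)"
  proof (rule measure_negligible_symdiff)
    show "?P \<union> ?N \<in> lmeasurable" using P N by (rule fmeasurable.Un)
    show "negligible ((?P \<union> ?N - S) \<union> (S - (?P \<union> ?N)))"
      using assms(3) by (intro negligible_subset[OF negligible_hyperplane[of a 0]]) auto
  qed
  also have "\<dots> = measure lebesgue ?P + measure lebesgue ?N"
    using P N by (intro measure_Union) (auto simp: fmeasurable_def less_top)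
  finally show ?thesis using eq by simp
qed

lemma integral_balanced_halfspace:
  fixes S :: "'a::euclidean_space set"
  assumes "S \<in> lmeasurable" and "S = uminus ` S" and "a \<noteq> 0"
  shows "(LINT y|lebesgue. indicator (S \<inter> {y. a \<bullet> y > 0}) y) = measure lebesgue S / 2"
  using measure_balanced_halfspace[OF assms] by simp

section \<open>Equality up to null sets\<close>

lemma null_eq_iff_negligible: "null_eq A B \<longleftrightarrow> negligible ((A - B) \<union> (B - A))"
  by (simp add: null_eq_def negligible_iff_null_sets)

lemma null_eq_sym: "null_eq A B \<Longrightarrow> null_eq B A"
  by (simp add: null_eq_def Un_commute)

lemma null_eq_trans: "null_eq A B \<Longrightarrow> null_eq B C \<Longrightarrow> null_eq A C"
  unfolding null_eq_iff_negligible
  by (rule negligible_subset[OF negligible_Un, of "(A - B) \<union> (B - A)" "(B - C) \<union> (C - B)"]) auto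

lemma null_eq_Diff: "null_eq A B \<Longrightarrow> null_eq (S - A) (S - B)"
  unfolding null_eq_iff_negligible by (erule negligible_subset) auto

lemma null_eq_linear_image:
  fixes f :: "'a::euclidean_space \<Rightarrow> 'a"
  assumes "linear f" and "null_eq A B"
  shows "null_eq (f ` A) (f ` B)"
proof -
  have "negligible (f ` ((A - B) \<union> (B - A)))"
    using assms unfolding null_eq_iff_negligible
    by (intro negligible_differentiable_image_negligible)
      (auto intro: linear_imp_differentiable_on)
  then show ?thesis
    unfolding null_eq_iff_negligible by (rule negligible_subset) auto
qed

lemma linear_R: "linear (R :: 'a \<times> 'b::real_vector \<Rightarrow> 'a::real_vector \<times> 'b)"
  by (intro linearI) (auto simp: R_def)

section \<open>The minimizer\<close>

definition acute_pairs :: "'a::real_inner set \<Rightarrow> 'a set \<Rightarrow> ('a \<times> 'a) set" where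
  "acute_pairs A B = {(x, y). (x, y) \<in> A \<times> B \<and> x \<bullet> y > 0}"

lemma hbar2_acute_pairs:
  "hbar2 A B z * indicator (acute_pairs A B) z = hbar2 A B z * indicator {z. fst z \<bullet> snd z > 0} z"
  by (auto simp: hbar2_def acute_pairs_def indicator_def split: prod.splits)

lemma lebesgue_acute_pairs:
  fixes A B :: "'a::euclidean_space set"
  assumes "A \<in> sets lebesgue" and "B \<in> sets lebesgue"
  shows "acute_pairs A B \<in> sets lebesgue"
proof -
  have "open {z :: 'a \<times> 'a. 0 < fst z \<bullet> snd z}"
    by (intro open_Collect_less continuous_intros)
  moreover have "acute_pairs A B = (A \<times> B) \<inter> {z. 0 < fst z \<bullet> snd z}"
    by (auto simp: acute_pairs_def)
  ultimately show ?thesis using lebesgue_Times[OF assms] by (simp add: sets.Int)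
qed

text \<open>
  The slice at \<open>x\<close> is twice the indicator of half of \<open>\<Lambda>\<close> when \<open>x\<close> lies in \<open>\<Omega>\<close> and zero otherwise;
  the single exceptional point \<open>x = 0\<close> is a null set.
\<close>

lemma hbar2_acute_pairs_marginals:
  fixes \<Omega> \<Lambda> :: "'a::euclidean_space set"
  assumes "\<Omega> \<in> lmeasurable" "measure lebesgue \<Omega> = 1" "\<Omega> = uminus ` \<Omega>"
    and "\<Lambda> \<in> lmeasurable" "measure lebesgue \<Lambda> = 1" "\<Lambda> = uminus ` \<Lambda>"
  defines "u \<equiv> \<lambda>z. hbar2 \<Omega> \<Lambda> z * indicator (acute_pairs \<Omega> \<Lambda>) z"
  shows "AE x in lebesgue. (LINT y|lebesgue. u (x, y)) = indicator \<Omega> x"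
    and "AE y in lebesgue. (LINT x|lebesgue. u (x, y)) = indicator \<Lambda> y"
proof -
  have nz: "AE x in lebesgue. x \<noteq> (0::'a)"
    by (rule AE_completion) (rule AE_lborel_singleton)
  have 1: "u (x, y) = (2 * indicator \<Omega> x) * indicator (\<Lambda> \<inter> {y. x \<bullet> y > 0}) y" for x y
    by (simp add: u_def hbar2_def acute_pairs_def indicator_def)
  have 2: "u (x, y) = (2 * indicator \<Lambda> y) * indicator (\<Omega> \<inter> {x. y \<bullet> x > 0}) x" for x y
    by (simp add: u_def hbar2_def acute_pairs_def indicator_def inner_commute)
  show "AE x in lebesgue. (LINT y|lebesgue. u (x, y)) = indicator \<Omega> x"
    using nz
  proof eventually_elim
    case (elim x)
    then show ?case
      unfolding 1 integral_mult_right_zero integral_balanced_halfspace[OF assms(4,6) elim]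
      by (simp add: assms(5))
  qed
  show "AE y in lebesgue. (LINT x|lebesgue. u (x, y)) = indicator \<Lambda> y"
    using nz
  proof eventually_elim
    case (elim y)
    then show ?case
      unfolding 2 integral_mult_right_zero integral_balanced_halfspace[OF assms(1,3) elim]
      by (simp add: assms(2))
  qed
qed

lemma hbar2_acute_pairs_in_couplings:
  fixes \<Omega> \<Lambda> :: "'a::euclidean_space set"
  assumes "bounded \<Omega>" "\<Omega> \<in> sets lebesgue" "measure lebesgue \<Omega> = 1" "\<Omega> = uminus ` \<Omega>"
    and "bounded \<Lambda>" "\<Lambda> \<in> sets lebesgue" "measure lebesgue \<Lambda> = 1" "\<Lambda> = uminus ` \<Lambda>"
  shows "(\<lambda>z. hbar2 \<Omega> \<Lambda> z * indicator (acute_pairs \<Omega> \<Lambda>) z)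
    \<in> couplings (indicator \<Omega>) (indicator \<Lambda>) (hbar2 \<Omega> \<Lambda>)"
proof -
  let ?u = "\<lambda>z. hbar2 \<Omega> \<Lambda> z * indicator (acute_pairs \<Omega> \<Lambda>) z"
  have lm: "\<Omega> \<in> lmeasurable" "\<Lambda> \<in> lmeasurable"
    using assms by (auto intro: bounded_set_imp_lmeasurable)
  have sub: "acute_pairs \<Omega> \<Lambda> \<subseteq> \<Omega> \<times> \<Lambda>" by (auto simp: acute_pairs_def)
  have "acute_pairs \<Omega> \<Lambda> \<in> lmeasurable"
    using assms by (intro bounded_set_imp_lmeasurable lebesgue_acute_pairs
        bounded_subset[OF bounded_Times sub])
  then have "integrable lebesgue (\<lambda>z. 2 * indicator (acute_pairs \<Omega> \<Lambda>) z :: real)"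
    by (intro integrable_mult_right) (simp only: lmeasurable_iff_integrable)
  moreover have "?u = (\<lambda>z. 2 * indicator (acute_pairs \<Omega> \<Lambda>) z)"
    using sub by (auto simp: hbar2_def indicator_def fun_eq_iff)
  ultimately have "integrable lebesgue ?u" by simp
  moreover have "0 \<le> ?u z" "?u z \<le> hbar2 \<Omega> \<Lambda> z" for z
    by (auto simp: hbar2_def indicator_def)
  ultimately show ?thesis
    using hbar2_acute_pairs_marginals[OF lm(1) assms(3,4) lm(2) assms(7,8)]
    unfolding couplings_def by simp
qed

lemma couplings_integrable_inner:
  fixes \<Omega> \<Lambda> :: "'a::euclidean_space set"
  assumes "bounded \<Omega>" "bounded \<Lambda>" and "h \<in> couplings f g (hbar2 \<Omega> \<Lambda>)"
  shows "integrable lebesgue (\<lambda>z. (fst z \<bullet> snd z) * h z)"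
proof (rule integrable_continuous_mult_bounded_support)
  show "continuous_on UNIV (\<lambda>z :: 'a \<times> 'a. fst z \<bullet> snd z)" by (intro continuous_intros)
  show "integrable lebesgue h" using assms(3) by (simp add: couplings_def)
  show "bounded (\<Omega> \<times> \<Lambda>)" using assms(1,2) by (rule bounded_Times)
  have "AE z in lebesgue. 0 \<le> h z" "AE z in lebesgue. h z \<le> hbar2 \<Omega> \<Lambda> z"
    using assms(3) by (auto simp: couplings_def)
  then show "AE z in lebesgue. z \<notin> \<Omega> \<times> \<Lambda> \<longrightarrow> h z = 0"
  proof eventually_elim
    case (elim z)
    then show ?case by (cases "z \<in> \<Omega> \<times> \<Lambda>") (simp_all add: hbar2_def)
  qed
qed

text \<open>
  The bathtub principle compares the candidate with every \<open>h\<close> between \<open>0\<close> and \<open>hbar2\<close>; the marginals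
  enter only through the fact that the candidate itself has the right ones.
\<close>

lemma acute_pairs_minimizer:
  fixes \<Omega> \<Lambda> :: "'a::euclidean_space set"
  assumes "bounded \<Omega>" "\<Omega> \<in> sets lebesgue" "measure lebesgue \<Omega> = 1" "\<Omega> = uminus ` \<Omega>"
    and "bounded \<Lambda>" "\<Lambda> \<in> sets lebesgue" "measure lebesgue \<Lambda> = 1" "\<Lambda> = uminus ` \<Lambda>"
  defines "c \<equiv> \<lambda>x y. - (x \<bullet> y)"
    and "\<Gamma> \<equiv> couplings (indicator \<Omega>) (indicator \<Lambda>) (hbar2 \<Omega> \<Lambda>)"
    and "u \<equiv> \<lambda>z. hbar2 \<Omega> \<Lambda> z * indicator (acute_pairs \<Omega> \<Lambda>) z"
  shows "cost_minimizer c \<Gamma> u"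
    and "cost_minimizer c \<Gamma> h \<Longrightarrow> AE z in lebesgue. h z = u z"
proof -
  have u: "u = (\<lambda>z. hbar2 \<Omega> \<Lambda> z * indicator {z. fst z \<bullet> snd z > 0} z)"
    unfolding u_def by (simp add: hbar2_acute_pairs)
  have u\<Gamma>: "u \<in> \<Gamma>"
    unfolding u_def \<Gamma>_def by (rule hbar2_acute_pairs_in_couplings[OF assms(1-8)])
  have int: "integrable lebesgue (\<lambda>z. (fst z \<bullet> snd z) * h z)" if "h \<in> \<Gamma>" for h
    using couplings_integrable_inner[OF assms(1,5)] that unfolding \<Gamma>_def .
  have box: "AE z in lebesgue. 0 \<le> h z" "AE z in lebesgue. h z \<le> hbar2 \<Omega> \<Lambda> z" if "h \<in> \<Gamma>" for h
    using that by (auto simp: \<Gamma>_def couplings_def)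
  have cost: "transport_cost c h = - (LINT z|lebesgue. (fst z \<bullet> snd z) * h z)" for h
    by (simp add: transport_cost_def c_def)
  show "cost_minimizer c \<Gamma> u"
    unfolding cost_minimizer_def cost
    using u\<Gamma> bathtub_le[OF int int[OF u\<Gamma>, unfolded u] box] by (simp add: u)
  assume "cost_minimizer c \<Gamma> h"
  then have h: "h \<in> \<Gamma>" "transport_cost c h \<le> transport_cost c u"
    using u\<Gamma> by (auto simp: cost_minimizer_def)
  show "AE z in lebesgue. h z = u z"
    using bathtub_unique[OF int[OF h(1)] int[OF u\<Gamma>, unfolded u] box[OF h(1)] AE_not_orthogonal] h(2)
    by (simp add: cost u)
qed

section \<open>Symmetries of the acute pairs\<close>

text \<open>
  The complement is given by \<open>x \<bullet> y \<le> 0\<close>, and \<open>R\<close> maps the rectangle to itself while changing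
  the sign of \<open>x \<bullet> y\<close>.
\<close>

lemma R_image_compl_acute_pairs:
  fixes A B :: "'a::euclidean_space set"
  assumes "B = uminus ` B"
  shows "R ` (A \<times> B - acute_pairs A B) = {z \<in> A \<times> B. 0 \<le> fst z \<bullet> snd z}"
proof -
  have bal: "- y \<in> B \<longleftrightarrow> y \<in> B" for y
    using assms by (metis image_eqI minus_minus rev_image_eqI)
  have "z \<in> R ` (A \<times> B - acute_pairs A B)" if "z \<in> A \<times> B" "0 \<le> fst z \<bullet> snd z" for z
    using that bal by (intro image_eqI[of _ _ "R z"]) (auto simp: R_def acute_pairs_def)
  then show ?thesis
    using bal by (auto simp: R_def acute_pairs_def)
qed

text \<open>The inner product is unchanged when both arguments change sign.\<close>

lemma uminus_image_R_compl_acute_pairs: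
  fixes A B :: "'a::euclidean_space set"
  assumes "A = uminus ` A" and "B = uminus ` B"
  shows "uminus ` R ` (A \<times> B - acute_pairs A B) = R ` (A \<times> B - acute_pairs A B)"
proof -
  have bal: "- x \<in> A \<longleftrightarrow> x \<in> A" "- y \<in> B \<longleftrightarrow> y \<in> B" for x y
    using assms by (metis image_eqI minus_minus rev_image_eqI)+
  let ?Q = "{z \<in> A \<times> B. 0 \<le> fst z \<bullet> snd z}"
  have "z \<in> uminus ` ?Q" if "z \<in> ?Q" for z
    using that bal by (intro image_eqI[of _ _ "- z"]) auto
  then have "uminus ` ?Q = ?Q"
    using bal by auto
  then show ?thesis unfolding R_image_compl_acute_pairs[OF assms(2)] .
qed

lemma null_eq_acute_pairs_R_compl:
  fixes A B :: "'a::euclidean_space set"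
  assumes "B = uminus ` B"
  shows "null_eq (acute_pairs A B) (R ` (A \<times> B - acute_pairs A B))"
proof -
  obtain N where N: "{z :: 'a \<times> 'a. fst z \<bullet> snd z = 0} \<subseteq> N" "N \<in> null_sets lebesgue"
    using AE_not_orthogonal[where 'a = 'a] by (auto simp: eventually_ae_filter)
  then have "negligible N" by (simp add: negligible_iff_null_sets)
  then show ?thesis
    unfolding R_image_compl_acute_pairs[OF assms] null_eq_iff_negligible
    by (rule negligible_subset) (use N(1) in \<open>force simp: acute_pairs_def less_le\<close>)
qed

text \<open>On the rectangle \<open>hbar2\<close> is nonzero, so the density determines the set carrying it.\<close>

lemma null_eq_support:
  assumes "W \<subseteq> A \<times> B" and "V \<subseteq> A \<times> B"
    and "AE z in lebesgue. hbar2 A B z * indicator W z = hbar2 A B z * indicator V z"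
  shows "null_eq W V"
proof -
  obtain N where N: "{z. hbar2 A B z * indicator W z \<noteq> hbar2 A B z * indicator V z} \<subseteq> N"
      "N \<in> null_sets lebesgue"
    using assms(3) by (auto simp: eventually_ae_filter)
  have "(W - V) \<union> (V - W) \<subseteq> {z. hbar2 A B z * indicator W z \<noteq> hbar2 A B z * indicator V z}"
    using assms(1,2) by (auto simp: hbar2_def indicator_def)
  with N(1) have "(W - V) \<union> (V - W) \<subseteq> N" by blast
  moreover have "negligible N" using N(2) by (simp add: negligible_iff_null_sets)
  ultimately show ?thesis
    unfolding null_eq_iff_negligible by (blast intro: negligible_subset)
qed

theorem proposition4p2:
  fixes \<Omega> \<Lambda> :: "(real ^ 'd) set" and c :: "real ^ 'd \<Rightarrow> real ^ 'd \<Rightarrow> real"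
  assumes "bounded \<Omega>" and "\<Omega> \<in> sets lebesgue" and "measure lebesgue \<Omega> = 1"
    and "bounded \<Lambda>" and "\<Lambda> \<in> sets lebesgue" and "measure lebesgue \<Lambda> = 1"
    and "\<Omega> = uminus ` \<Omega>" and "\<Lambda> = uminus ` \<Lambda>"
    and "c = (\<lambda>x y. - (x \<bullet> y))"
  shows "let \<Gamma> = couplings (indicator \<Omega>) (indicator \<Lambda>) (hbar2 \<Omega> \<Lambda>) in
    (\<exists>h. cost_minimizer c \<Gamma> h) \<and>
    (\<forall>h h'. cost_minimizer c \<Gamma> h \<and> cost_minimizer c \<Gamma> h' \<longrightarrow> (AE z in lebesgue. h z = h' z)) \<and>
    (\<forall>h. cost_minimizer c \<Gamma> h \<longrightarrow>
      (\<exists>W. W \<in> sets lebesgue \<and> W \<subseteq> \<Omega> \<times> \<Lambda> \<and>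
         (AE z in lebesgue. h z = hbar2 \<Omega> \<Lambda> z * indicator W z)) \<and>
      (\<forall>W. W \<in> sets lebesgue \<and> W \<subseteq> \<Omega> \<times> \<Lambda> \<and>
         (AE z in lebesgue. h z = hbar2 \<Omega> \<Lambda> z * indicator W z) \<longrightarrow>
         null_eq W (R ` (\<Omega> \<times> \<Lambda> - W)) \<and>
         null_eq (R ` (\<Omega> \<times> \<Lambda> - W)) (uminus ` R ` (\<Omega> \<times> \<Lambda> - W)) \<and>
         null_eq W {(x, y). (x, y) \<in> \<Omega> \<times> \<Lambda> \<and> x \<bullet> y > 0}))"
proof -
  define \<Gamma> where "\<Gamma> = couplings (indicator \<Omega>) (indicator \<Lambda>) (hbar2 \<Omega> \<Lambda>)"
  let ?P = "acute_pairs \<Omega> \<Lambda>"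
  let ?u = "\<lambda>z. hbar2 \<Omega> \<Lambda> z * indicator ?P z"
  note min = acute_pairs_minimizer[OF assms(1-3,7,4-6,8), folded assms(9) \<Gamma>_def]
  have P: "?P \<in> sets lebesgue" "?P \<subseteq> \<Omega> \<times> \<Lambda>"
    using lebesgue_acute_pairs[OF assms(2,5)] by (auto simp: acute_pairs_def)
  have uniq: "AE z in lebesgue. h z = h' z" if "cost_minimizer c \<Gamma> h" "cost_minimizer c \<Gamma> h'" for h h'
    using min(2)[OF that(1)] min(2)[OF that(2)] by eventually_elim simp
  have sym: "null_eq W (R ` (\<Omega> \<times> \<Lambda> - W)) \<and>
      null_eq (R ` (\<Omega> \<times> \<Lambda> - W)) (uminus ` R ` (\<Omega> \<times> \<Lambda> - W)) \<and> null_eq W ?P"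
    if h: "cost_minimizer c \<Gamma> h" and W: "W \<subseteq> \<Omega> \<times> \<Lambda>"
      and hW: "AE z in lebesgue. h z = hbar2 \<Omega> \<Lambda> z * indicator W z" for h W
  proof -
    have "AE z in lebesgue. hbar2 \<Omega> \<Lambda> z * indicator W z = ?u z"
      using hW min(2)[OF h] by eventually_elim (simp only:)
    then have WP: "null_eq W ?P" by (rule null_eq_support[OF W P(2)])
    then have RW: "null_eq (R ` (\<Omega> \<times> \<Lambda> - ?P)) (R ` (\<Omega> \<times> \<Lambda> - W))"
      by (intro null_eq_linear_image linear_R null_eq_Diff null_eq_sym[OF WP])
    have "linear (uminus :: (real ^ 'd) \<times> (real ^ 'd) \<Rightarrow> _)"
      by (intro linearI) auto
    from null_eq_linear_image[OF this RW]
    have mRW: "null_eq (R ` (\<Omega> \<times> \<Lambda> - ?P)) (uminus ` R ` (\<Omega> \<times> \<Lambda> - W))"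
      unfolding uminus_image_R_compl_acute_pairs[OF assms(7,8)] .
    show ?thesis
      using null_eq_trans[OF null_eq_trans[OF WP null_eq_acute_pairs_R_compl[OF assms(8)]] RW]
        null_eq_trans[OF null_eq_sym[OF RW] mRW] WP by blast
  qed
  show ?thesis
    unfolding Let_def \<Gamma>_def[symmetric] acute_pairs_def[symmetric]
    using min uniq sym P by blast
qed

end
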